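(* Let $S$ be a semigroup with a stable minimal ideal $M$. If $\mathscr C=(I,N)$ is an IN-pair on $S$, then $R_{\mathscr C}=R_{I,N}$ is a congruence on $S$. Furthermore, if $\mathscr C=(I,N)$ is retractable, and if $\xi$ is a liftable congruence on $M$, then $\zeta_{I,N,\xi}$ is also a congruence on $S$. In particular, $\lambda_{\mathscr C}$, $\rho_{\mathscr C}$, $\mu_{\mathscr C}$ and $\eta_{\mathscr C}$ are all congruences on $S$ if $\mathscr C$ is retractable.
   Context: $S$ may be infinite. $S^1$ is $S$ with an identity adjoined if necessary; $\mathscr R,\mathscr L,\mathscr H,\mathscr J$ are Green's relations on $S$; $\mathscr J$-classes are ordered by $J_a\le J_b$ iff $a\in S^1bS^1$; $\Delta_S=\{(a,a):a\in S\}$. Ideals are non-empty. A minimal ideal, if it exists, is a single $\mathscr J$-class. A $\mathscr J$-class $J$ is stable if for all $x\in J$ and $a\in S$: $xa\mathrel{\mathscr J}x\Rightarrow xa\mathrel{\mathscr R}x$ and $ax\mathrel{\mathscr J}x\Rightarrow ax\mathrel{\mathscr L}x$; it is regular if every $x\in J$ satisfies $x=xyx$ for some $y\in S$. (A stable minimal ideal is regular.) An ideal $I$ is retractable if there is a homomorphism $f:I\to M$ (a retraction) with $xf=x$ for all $x\in M$; when $M$ is regular, $f$ is unique. A congruence $\xi$ on $M$ is liftable if $\Delta_S\cup\xi$ is a congruence on $S$ (equivalently, $(xs,ys),(sx,sy)\in\xi$ for all $(x,y)\in\xi$, $s\in S$). The restrictions $\mathscr L^M,\mathscr R^M,\mathscr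 H^M$ of $\mathscr L,\mathscr R,\mathscr H$ to $M$ and the equality relation $\Delta_M$ are liftable congruences when $M$ is stable. An IN-pair is a pair $\mathscr C=(I,N)$ where $I$ is an ideal of $S$ and $N$ is a normal subgroup of a maximal subgroup of $S$ contained in some stable, regular $\mathscr J$-class $J$ that is minimal among the $\mathscr J$-classes contained in $S\setminus I$. Put $$\nu_N=\{(sxt,syt)\in J\times J:x,y\in N,\ s,t\in S^1\},\qquad R_{I,N}=\Delta_S\cup\nu_N\cup(I\times I).$$ The IN-pair is retractable if $I$ is retractable and $|xN|=|Nx|=1$ for all $x\in M$. For a retractable IN-pair, with retraction $f:I\to M$, and a liftable congruence $\xi$ on $M$, $$\zeta_{I,N,\xi}=\Delta_S\cup\nu_N\cup\{(x,y)\in I\times I:(xf,yf)\in\xi\},$$ and $\lambda_{\mathscr C}=\zeta_{I,N,\mathscr L^M}$, $\rho_{\mathscr C}=\zeta_{I,N,\mathscr R^M}$, $\mu_{\mathscr C}=\zeta_{I,N,\mathscr H^M}$, $\eta_{\mathscr C}=\zeta_{I,N,\Delta_M}$. *)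

theory Defs
  imports Main "HOL-Algebra.Coset"
begin

text \<open>
  The semigroup $S$ is the type \<open>'a :: semigroup_mult\<close>.  Its binary relations are
  sets of pairs, so \<open>Id\<close> is the diagonal $\Delta_S$.
\<close>

text \<open>
  $S^1$ consists of options: \<open>Some s\<close> is the element \<open>s\<close> of $S$, and \<open>None\<close> is the
  adjoined identity, which is present only if $S$ has no identity of its own.
\<close>

definition S1 :: "'a::semigroup_mult option set" where
  "S1 = (if \<exists>e::'a. \<forall>x. e * x = x \<and> x * e = x then range Some else UNIV)"

fun lmult1 :: "'a::semigroup_mult option \<Rightarrow> 'a \<Rightarrow> 'a" where
  "lmult1 None x = x"
| "lmult1 (Some s) x = s * x"

fun rmult1 :: "'a::semigroup_mult \<Rightarrow> 'a option \<Rightarrow> 'a" where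
  "rmult1 x None = x"
| "rmult1 x (Some t) = x * t"

definition right_ideal1 :: "'a::semigroup_mult \<Rightarrow> 'a set" where
  "right_ideal1 x = {rmult1 x t | t. t \<in> S1}"

definition left_ideal1 :: "'a::semigroup_mult \<Rightarrow> 'a set" where
  "left_ideal1 x = {lmult1 s x | s. s \<in> S1}"

definition ideal1 :: "'a::semigroup_mult \<Rightarrow> 'a set" where
  "ideal1 x = {rmult1 (lmult1 s x) t | s t. s \<in> S1 \<and> t \<in> S1}"

definition green_R :: "'a::semigroup_mult rel" where
  "green_R = {(x, y). right_ideal1 x = right_ideal1 y}"

definition green_L :: "'a::semigroup_mult rel" where
  "green_L = {(x, y). left_ideal1 x = left_ideal1 y}"

definition green_H :: "'a::semigroup_mult rel" where
  "green_H = green_L \<inter> green_R"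

definition green_J :: "'a::semigroup_mult rel" where
  "green_J = {(x, y). ideal1 x = ideal1 y}"

definition J_classes :: "'a::semigroup_mult set set" where
  "J_classes = UNIV // green_J"

text \<open>On $\mathscr J$-classes the choice of representatives in the next definition is immaterial.\<close>

definition J_le :: "'a::semigroup_mult set \<Rightarrow> 'a set \<Rightarrow> bool" where
  "J_le A B \<longleftrightarrow> (\<exists>a\<in>A. \<exists>b\<in>B. a \<in> ideal1 b)"

definition stable_class :: "'a::semigroup_mult set \<Rightarrow> bool" where
  "stable_class J \<longleftrightarrow> (\<forall>x\<in>J. \<forall>a.
      ((x * a, x) \<in> green_J \<longrightarrow> (x * a, x) \<in> green_R) \<and>
      ((a * x, x) \<in> green_J \<longrightarrow> (a * x, x) \<in> green_L))"

definition regular_class :: "'a::semigroup_mult set \<Rightarrow> bool" where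
  "regular_class J \<longleftrightarrow> (\<forall>x\<in>J. \<exists>y. x = x * y * x)"

definition sg_ideal :: "'a::semigroup_mult set \<Rightarrow> bool" where
  "sg_ideal I \<longleftrightarrow> I \<noteq> {} \<and> (\<forall>x\<in>I. \<forall>s. s * x \<in> I \<and> x * s \<in> I)"

definition minimal_ideal :: "'a::semigroup_mult set \<Rightarrow> bool" where
  "minimal_ideal M \<longleftrightarrow> sg_ideal M \<and> (\<forall>I. sg_ideal I \<and> I \<subseteq> M \<longrightarrow> I = M)"

definition congruence_on :: "'a::semigroup_mult set \<Rightarrow> 'a rel \<Rightarrow> bool" where
  "congruence_on A \<sigma> \<longleftrightarrow> equiv A \<sigma> \<and>
     (\<forall>x y. (x, y) \<in> \<sigma> \<longrightarrow> (\<forall>s\<in>A. (s * x, s * y) \<in> \<sigma> \<and> (x * s, y * s) \<in> \<sigma>))"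

abbreviation congruence :: "'a::semigroup_mult rel \<Rightarrow> bool" where
  "congruence \<equiv> congruence_on UNIV"

definition liftable :: "'a::semigroup_mult set \<Rightarrow> 'a rel \<Rightarrow> bool" where
  "liftable M \<xi> \<longleftrightarrow> congruence_on M \<xi> \<and> congruence (Id \<union> \<xi>)"

text \<open>
  The identity \<open>e\<close> of a subgroup of $S$ is an idempotent, not necessarily an identity of $S$.
\<close>

abbreviation grp :: "'a::semigroup_mult set \<Rightarrow> 'a \<Rightarrow> 'a monoid" where
  "grp G e \<equiv> \<lparr>carrier = G, monoid.mult = (*), one = e\<rparr>"

definition sg_subgroup :: "'a::semigroup_mult set \<Rightarrow> bool" where
  "sg_subgroup G \<longleftrightarrow> (\<exists>e. group (grp G e))"

definition maximal_subgroup :: "'a::semigroup_mult set \<Rightarrow> bool" where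
  "maximal_subgroup G \<longleftrightarrow>
     sg_subgroup G \<and> (\<forall>H. sg_subgroup H \<and> G \<subseteq> H \<longrightarrow> H = G)"

definition normal_subgroup :: "'a::semigroup_mult set \<Rightarrow> 'a set \<Rightarrow> bool" where
  "normal_subgroup N G \<longleftrightarrow> (\<exists>e. N \<lhd> grp G e)"

definition minimal_J_class_outside :: "'a::semigroup_mult set \<Rightarrow> 'a set \<Rightarrow> bool" where
  "minimal_J_class_outside I J \<longleftrightarrow>
     J \<in> J_classes \<and> J \<subseteq> - I \<and>
     (\<forall>K\<in>J_classes. K \<subseteq> - I \<and> J_le K J \<longrightarrow> K = J)"

definition IN_pair :: "'a::semigroup_mult set \<Rightarrow> 'a set \<Rightarrow> bool" where
  "IN_pair I N \<longleftrightarrow> sg_ideal I \<and>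
     (\<exists>J G. minimal_J_class_outside I J \<and> stable_class J \<and> regular_class J \<and>
            maximal_subgroup G \<and> G \<subseteq> J \<and> normal_subgroup N G)"

text \<open>
  For an IN-pair \<open>(I, N)\<close>, the image \<open>green_J `` N\<close> is the unique $\mathscr J$-class
  containing \<open>N\<close>, that is, the class \<open>J\<close> in the definition of an IN-pair.
\<close>

definition nu :: "'a::semigroup_mult set \<Rightarrow> 'a rel" where
  "nu N = {(rmult1 (lmult1 s x) t, rmult1 (lmult1 s y) t) | s t x y.
             x \<in> N \<and> y \<in> N \<and> s \<in> S1 \<and> t \<in> S1}
          \<inter> (green_J `` N) \<times> (green_J `` N)"

definition R_rel :: "'a::semigroup_mult set \<Rightarrow> 'a set \<Rightarrow> 'a rel" where
  "R_rel I N = Id \<union> nu N \<union> I \<times> I"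

definition retraction :: "'a::semigroup_mult set \<Rightarrow> 'a set \<Rightarrow> ('a \<Rightarrow> 'a) \<Rightarrow> bool" where
  "retraction M I f \<longleftrightarrow> (\<forall>x\<in>I. f x \<in> M) \<and>
     (\<forall>x\<in>I. \<forall>y\<in>I. f (x * y) = f x * f y) \<and> (\<forall>x\<in>M. f x = x)"

definition retractable_ideal :: "'a::semigroup_mult set \<Rightarrow> 'a set \<Rightarrow> bool" where
  "retractable_ideal M I \<longleftrightarrow> sg_ideal I \<and> (\<exists>f. retraction M I f)"

definition retractable_IN_pair ::
  "'a::semigroup_mult set \<Rightarrow> 'a set \<Rightarrow> 'a set \<Rightarrow> bool" where
  "retractable_IN_pair M I N \<longleftrightarrow> IN_pair I N \<and> retractable_ideal M I \<and>
     (\<forall>x\<in>M. card ((\<lambda>n. x * n) ` N) = 1 \<and> card ((\<lambda>n. n * x) ` N) = 1)"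

text \<open>
  The retraction \<open>f\<close> is an explicit argument below.  Only its values on \<open>I\<close> matter,
  and these are determined by \<open>M\<close> and \<open>I\<close> when \<open>M\<close> is regular.
\<close>

definition zeta ::
  "('a \<Rightarrow> 'a) \<Rightarrow> 'a::semigroup_mult set \<Rightarrow> 'a set \<Rightarrow> 'a rel \<Rightarrow> 'a rel" where
  "zeta f I N \<xi> = Id \<union> nu N \<union> {(x, y). x \<in> I \<and> y \<in> I \<and> (f x, f y) \<in> \<xi>}"

definition lambda_rel ::
  "'a::semigroup_mult set \<Rightarrow> ('a \<Rightarrow> 'a) \<Rightarrow> 'a set \<Rightarrow> 'a set \<Rightarrow> 'a rel" where
  "lambda_rel M f I N = zeta f I N (green_L \<inter> M \<times> M)"

definition rho_rel ::
  "'a::semigroup_mult set \<Rightarrow> ('a \<Rightarrow> 'a) \<Rightarrow> 'a set \<Rightarrow> 'a set \<Rightarrow> 'a rel" where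
  "rho_rel M f I N = zeta f I N (green_R \<inter> M \<times> M)"

definition mu_rel ::
  "'a::semigroup_mult set \<Rightarrow> ('a \<Rightarrow> 'a) \<Rightarrow> 'a set \<Rightarrow> 'a set \<Rightarrow> 'a rel" where
  "mu_rel M f I N = zeta f I N (green_H \<inter> M \<times> M)"

definition eta_rel ::
  "'a::semigroup_mult set \<Rightarrow> ('a \<Rightarrow> 'a) \<Rightarrow> 'a set \<Rightarrow> 'a set \<Rightarrow> 'a rel" where
  "eta_rel M f I N = zeta f I N (Id_on M)"

end

theory Submission
  imports Defs
begin

text \<open>
  Let \<open>e\<close> be the identity of \<open>N\<close>.  Since \<open>x = e x e\<close> for \<open>x \<in> N\<close>, the pairs in \<open>\<nu>\<^sub>N\<close> are the pairs
  \<open>(h x k, h y k)\<close> in \<open>J \<times> J\<close> with \<open>h, k \<in> S\<close>.  By stability \<open>h x k\<close> lies in \<open>J\<close> exactly if \<open>h y k\<close>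
  does, and by minimality of \<open>J\<close> both lie in \<open>I\<close> otherwise; this gives compatibility.  If
  \<open>h y k = h' x' k'\<close> lies in \<open>J\<close>, then stability yields a unit \<open>g\<close> of \<open>e S e\<close> with \<open>h' e = h g\<close>, so that
  \<open>h' y' k' = h (g y' x'\<^sup>-\<^sup>1 g\<^sup>-\<^sup>1 y) k\<close>, and normality gives transitivity.

  For \<open>\<zeta>\<close>, the minimal ideal \<open>M\<close> is regular and hence weakly reductive: \<open>a = c\<close> as soon as
  \<open>a b = c b\<close> and \<open>b a = b c\<close> for all \<open>b \<in> M\<close>.  This shows both \<open>f (s x) = s f x\<close> for all \<open>s \<in> S\<close>, and
  \<open>f (h x k) = f (h y k)\<close> when \<open>x, y \<in> N\<close> act in the same way on \<open>M\<close>.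
\<close>

section \<open>Green's relations\<close>

lemma Some_in_S1 [simp]: "Some s \<in> S1"
  by (simp add: S1_def)

text \<open>If S has an identity \<open>e\<close>, then \<open>Some e\<close> acts exactly as
  \<open>None\<close> does. Quantifiers over \<open>S1\<close> can therefore range over all
  options.\<close>

lemma S1_representative:
  fixes s :: "'a::semigroup_mult option"
  obtains s' where "s' \<in> S1" "\<And>x. lmult1 s' x = lmult1 s x" "\<And>x. rmult1 x s' = rmult1 x s"
proof (cases "s \<in> S1")
  case True
  then show ?thesis by (rule that) auto
next
  case False
  then obtain e :: 'a where e: "\<And>x. e * x = x" "\<And>x. x * e = x" and "s = None"
    by (cases s) (auto simp: S1_def split: if_splits)
  with that[of "Some e"] show ?thesis by auto
qed

lemma right_ideal1_eq: "right_ideal1 x = insert x (range ((*) x))"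
proof -
  have "right_ideal1 x = range (rmult1 x)"
    unfolding right_ideal1_def by (auto, metis S1_representative rangeI)
  then show ?thesis by (simp add: UNIV_option_conv image_comp comp_def)
qed

lemma left_ideal1_eq: "left_ideal1 x = insert x (range (\<lambda>s. s * x))"
proof -
  have "left_ideal1 x = range (\<lambda>s. lmult1 s x)"
    unfolding left_ideal1_def by (auto, metis S1_representative)
  then show ?thesis by (simp add: UNIV_option_conv image_comp comp_def)
qed

lemma mem_ideal1: "a \<in> ideal1 b \<longleftrightarrow> (\<exists>s t. a = rmult1 (lmult1 s b) t)"
  unfolding ideal1_def mem_Collect_eq by (metis S1_representative)

lemma self_in_ideal1 [simp]: "x \<in> ideal1 x"
  unfolding mem_ideal1 by (metis lmult1.simps(1) rmult1.simps(1))

lemma sg_ideal_closed: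
  assumes "sg_ideal I" "x \<in> I"
  shows "s * x \<in> I" "x * s \<in> I"
  using assms by (auto simp: sg_ideal_def)

lemma ideal1_subset:
  assumes "sg_ideal I" "x \<in> I"
  shows "ideal1 x \<subseteq> I"
proof
  fix a assume "a \<in> ideal1 x"
  then obtain s t where "a = rmult1 (lmult1 s x) t" by (auto simp: mem_ideal1)
  then show "a \<in> I"
    using assms by (cases s; cases t) (auto simp: sg_ideal_def)
qed

lemma mult_in_ideal1:
  "s * x \<in> ideal1 x" "x * s \<in> ideal1 x"
  unfolding mem_ideal1 by (metis lmult1.simps rmult1.simps)+

lemma sg_ideal_ideal1: "sg_ideal (ideal1 x)"
proof -
  have "s * a \<in> ideal1 x \<and> a * s \<in> ideal1 x" if a_in: "a \<in> ideal1 x" for a s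
  proof -
    obtain p q where a: "a = rmult1 (lmult1 p x) q" using a_in unfolding mem_ideal1 by blast
    \<comment> \<open>\<open>rmult1 s p\<close> and \<open>lmult1 q s\<close> are the outer factors
      with a possible adjoined identity absorbed into \<open>s\<close>.\<close>
    have "s * a = rmult1 (lmult1 (Some (rmult1 s p)) x) q"
      "a * s = rmult1 (lmult1 p x) (Some (lmult1 q s))"
      unfolding a by (cases p; cases q; simp add: mult.assoc)+
    then show ?thesis unfolding mem_ideal1 by blast
  qed
  then show ?thesis using self_in_ideal1[of x] unfolding sg_ideal_def by blast
qed

lemma equiv_green:
  "equiv UNIV green_R" "equiv UNIV green_L" "equiv UNIV green_H" "equiv UNIV green_J"
  by (auto simp: equiv_def refl_on_def sym_def trans_def
      green_R_def green_L_def green_J_def green_H_def)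

lemma green_R_left_mult:
  assumes "(x, y) \<in> green_R"
  shows "(s * x, s * y) \<in> green_R"
proof -
  have "right_ideal1 (s * x) = (*) s ` right_ideal1 x" for x
    by (simp add: right_ideal1_eq image_comp comp_def mult.assoc)
  with assms show ?thesis by (simp add: green_R_def)
qed

lemma green_L_right_mult:
  assumes "(x, y) \<in> green_L"
  shows "(x * s, y * s) \<in> green_L"
proof -
  have "left_ideal1 (x * s) = (\<lambda>z. z * s) ` left_ideal1 x" for x
    by (simp add: left_ideal1_eq image_comp comp_def mult.assoc)
  with assms show ?thesis by (simp add: green_L_def)
qed

lemma J_class_green_J:
  assumes "J \<in> J_classes" "x \<in> J"
  shows "(x, y) \<in> green_J \<longleftrightarrow> y \<in> J"
  using assms by (auto simp: J_classes_def quotient_def green_J_def)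

text \<open>Stability puts \<open>x\<close> into \<open>right_ideal1 (x * a)\<close>, where the
  cofactor may still be the adjoined identity. If \<open>x = x * a\<close>, regularity supplies
  \<open>y * x\<close> as a cofactor in S. The other side is dual.\<close>

lemma stable_regular_classD:
  assumes J: "J \<in> J_classes" "stable_class J" "regular_class J" and x: "x \<in> J"
  shows "x * a \<in> J \<Longrightarrow> \<exists>b. x * a * b = x"
    and "a * x \<in> J \<Longrightarrow> \<exists>b. b * a * x = x"
proof -
  obtain y where y: "x = x * y * x" using J x by (auto simp: regular_class_def)
  have green_J: "(z, x) \<in> green_J" if "z \<in> J" for z
    using J_class_green_J[OF J(1) that] x by simp
  show "\<exists>b. x * a * b = x" if "x * a \<in> J"
  proof -
    have "(x * a, x) \<in> green_R"
      using J(2) x green_J[OF that] by (auto simp: stable_class_def)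
    then have "x \<in> right_ideal1 (x * a)"
      by (auto simp: green_R_def right_ideal1_eq)
    then show ?thesis
      using y unfolding right_ideal1_eq by (metis insertE mult.assoc rangeE)
  qed
  show "\<exists>b. b * a * x = x" if "a * x \<in> J"
  proof -
    have "(a * x, x) \<in> green_L"
      using J(2) x green_J[OF that] by (auto simp: stable_class_def)
    then have "x \<in> left_ideal1 (a * x)"
      by (auto simp: green_L_def left_ideal1_eq)
    then show ?thesis
      using y unfolding left_ideal1_eq by (metis insertE mult.assoc rangeE)
  qed
qed

section \<open>The minimal ideal\<close>

lemma minimal_ideal_sg_ideal: "minimal_ideal M \<Longrightarrow> sg_ideal M"
  by (simp add: minimal_ideal_def)

lemma minimal_ideal_green_J:
  assumes "minimal_ideal M" "x \<in> M" "y \<in> M"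
  shows "(x, y) \<in> green_J"
proof -
  have "ideal1 z = M" if "z \<in> M" for z
    using assms(1) that sg_ideal_ideal1 ideal1_subset unfolding minimal_ideal_def by blast
  with assms show ?thesis by (simp add: green_J_def)
qed

lemma minimal_ideal_subset:
  assumes "minimal_ideal M" "sg_ideal I"
  shows "M \<subseteq> I"
proof -
  from assms obtain m i where "m \<in> M" "i \<in> I"
    by (auto simp: minimal_ideal_def sg_ideal_def)
  \<comment> \<open>The product witnesses that the intersection is non-empty.\<close>
  with assms have "m * i \<in> M \<inter> I"
    by (auto simp: minimal_ideal_def sg_ideal_def)
  then have "sg_ideal (M \<inter> I)"
    using assms unfolding minimal_ideal_def sg_ideal_def by blast
  with assms show ?thesis unfolding minimal_ideal_def by blast
qed

text \<open>Multiples of \<open>x\<close> stay in \<open>M\<close>, a single J-class, so the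
  premises of stability hold for every \<open>a\<close>.\<close>

lemma stable_minimal_ideal_mult:
  assumes "minimal_ideal M" "stable_class M" "x \<in> M"
  shows "(x * a, x) \<in> green_R" "(a * x, x) \<in> green_L"
  using assms minimal_ideal_green_J minimal_ideal_sg_ideal sg_ideal_closed
  unfolding stable_class_def by blast+

lemma stable_minimal_ideal_regular:
  assumes "minimal_ideal M" "stable_class M"
  shows "regular_class M"
  unfolding regular_class_def
proof
  fix x assume "x \<in> M"
  from stable_minimal_ideal_mult[OF assms this, of x]
  have "x \<in> right_ideal1 (x * x)" "x \<in> left_ideal1 (x * x)"
    by (auto simp: green_R_def green_L_def right_ideal1_eq left_ideal1_eq)
  \<comment> \<open>If a cofactor is the adjoined identity, \<open>x\<close> is idempotent and
    \<open>y = x\<close> works.\<close>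
  then have "x = x * x \<or> (\<exists>b c. x = x * x * b \<and> x = c * (x * x))"
    by (auto simp: right_ideal1_eq left_ideal1_eq)
  then show "\<exists>y. x = x * y * x"
  proof
    assume "\<exists>b c. x = x * x * b \<and> x = c * (x * x)"
    then obtain b c where b: "x = x * x * b" and c: "x = c * (x * x)" by blast
    \<comment> \<open>The second factor of \<open>x * x * b\<close> is expanded by \<open>c\<close>,
      so that \<open>x * x * b\<close> reappears on the right and collapses to
      \<open>x\<close>.\<close>
    have "x = x * (c * (x * x)) * b" using b c by simp
    also have "\<dots> = x * c * (x * x * b)" by (simp add: mult.assoc)
    finally show ?thesis using b by auto
  qed metis
qed

text \<open>As \<open>v * c\<close> lies in \<open>M\<close>, \<open>c = c * v * c\<close> equals
  \<open>a * v * c\<close>, so \<open>a * w\<close> fixes \<open>c\<close> from the left. As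
  \<open>a * w\<close> lies in \<open>M\<close>, also \<open>a * w * a = a * w * c\<close>.\<close>

lemma regular_ideal_weakly_reductive:
  assumes M: "sg_ideal M" "regular_class M" and "a \<in> M" "c \<in> M"
    and right: "\<And>b. b \<in> M \<Longrightarrow> a * b = c * b" and left: "\<And>b. b \<in> M \<Longrightarrow> b * a = b * c"
  shows "a = c"
proof -
  obtain w v where w: "a = a * w * a" and v: "c = c * v * c"
    using assms(2-4) unfolding regular_class_def by meson
  have "c = a * v * c"
    using v right[of "v * c"] sg_ideal_closed[OF M(1) \<open>c \<in> M\<close>] by (simp add: mult.assoc)
  then have "a * w * c = c" using w by (metis mult.assoc)
  moreover have "a * w * a = a * w * c"
    using left sg_ideal_closed[OF M(1) \<open>a \<in> M\<close>] by simp
  ultimately show ?thesis using w by simp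
qed

section \<open>Liftable congruences on the minimal ideal\<close>

lemma liftableI:
  assumes "sg_ideal M" "equiv M \<xi>"
    and "\<And>x y s. (x, y) \<in> \<xi> \<Longrightarrow> (s * x, s * y) \<in> \<xi> \<and> (x * s, y * s) \<in> \<xi>"
  shows "liftable M \<xi>"
proof -
  have "equiv UNIV (Id \<union> \<xi>)"
    using assms(2) unfolding equiv_def refl_on_def sym_def trans_def by blast
  with assms show ?thesis
    unfolding liftable_def congruence_on_def by blast
qed

text \<open>The lifted congruence might only say that the two products are equal; as they lie in
  \<open>M\<close>, reflexivity of \<xi> covers this case.\<close>

lemma liftable_mult:
  assumes "sg_ideal M" "liftable M \<xi>" "(x, y) \<in> \<xi>"
  shows "(s * x, s * y) \<in> \<xi>" "(x * s, y * s) \<in> \<xi>"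
proof -
  have "equiv M \<xi>" using assms by (simp add: liftable_def congruence_on_def)
  then have "x \<in> M" using assms(3) by (auto simp: equiv_def)
  have refl: "(z, z) \<in> \<xi>" if "z \<in> M" for z
    using \<open>equiv M \<xi>\<close> that by (auto simp: equiv_def refl_on_def)
  have "(s * x, s * y) \<in> Id \<union> \<xi>" "(x * s, y * s) \<in> Id \<union> \<xi>"
    using assms(2,3) by (auto simp: liftable_def congruence_on_def)
  then show "(s * x, s * y) \<in> \<xi>" "(x * s, y * s) \<in> \<xi>"
    using refl sg_ideal_closed[OF assms(1) \<open>x \<in> M\<close>, of s] by auto
qed

lemma equiv_restrict: "equiv UNIV r \<Longrightarrow> equiv M (r \<inter> M \<times> M)"
  unfolding equiv_def refl_on_def sym_def trans_def by blast

lemma liftable_restrict: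
  assumes M: "sg_ideal M" and r: "equiv UNIV r"
    and mult: "\<And>x y s. \<lbrakk>(x, y) \<in> r; x \<in> M; y \<in> M\<rbrakk> \<Longrightarrow> (s * x, s * y) \<in> r \<and> (x * s, y * s) \<in> r"
  shows "liftable M (r \<inter> M \<times> M)"
proof (rule liftableI[OF M equiv_restrict[OF r]])
  fix x y s assume "(x, y) \<in> r \<inter> M \<times> M"
  then have "(x, y) \<in> r" "x \<in> M" "y \<in> M" by auto
  from mult[OF this] show "(s * x, s * y) \<in> r \<inter> M \<times> M \<and> (x * s, y * s) \<in> r \<inter> M \<times> M"
    using sg_ideal_closed[OF M \<open>x \<in> M\<close>] sg_ideal_closed[OF M \<open>y \<in> M\<close>] by simp
qed

lemma liftable_green:
  assumes M: "minimal_ideal M" "stable_class M"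
  shows "liftable M (green_L \<inter> M \<times> M)" "liftable M (green_R \<inter> M \<times> M)"
    "liftable M (green_H \<inter> M \<times> M)"
proof -
  note restrict = liftable_restrict[OF minimal_ideal_sg_ideal[OF M(1)]]
  \<comment> \<open>L is right compatible in general. On \<open>M\<close> it is also left
    compatible, because \<open>s * x\<close> is L-related to \<open>x\<close> by stability; dually
    for R.\<close>
  have L: "(s * x, s * y) \<in> green_L \<and> (x * s, y * s) \<in> green_L"
    if "(x, y) \<in> green_L" "x \<in> M" "y \<in> M" for x y s
    using that(1) green_L_right_mult[OF that(1), of s] stable_minimal_ideal_mult(2)[OF M that(2), of s]
      stable_minimal_ideal_mult(2)[OF M that(3), of s]
    by (simp add: green_L_def)
  have R: "(s * x, s * y) \<in> green_R \<and> (x * s, y * s) \<in> green_R"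
    if "(x, y) \<in> green_R" "x \<in> M" "y \<in> M" for x y s
    using that(1) green_R_left_mult[OF that(1), of s] stable_minimal_ideal_mult(1)[OF M that(2), of s]
      stable_minimal_ideal_mult(1)[OF M that(3), of s]
    by (simp add: green_R_def)
  show "liftable M (green_L \<inter> M \<times> M)"
    by (rule restrict[OF equiv_green(2) L])
  show "liftable M (green_R \<inter> M \<times> M)"
    by (rule restrict[OF equiv_green(1) R])
  show "liftable M (green_H \<inter> M \<times> M)"
  proof (rule restrict[OF equiv_green(3)])
    fix x y s assume "(x, y) \<in> green_H" "x \<in> M" "y \<in> M"
    then show "(s * x, s * y) \<in> green_H \<and> (x * s, y * s) \<in> green_H"
      using L[of x y s] R[of x y s] by (simp add: green_H_def)
  qed
qed

lemma liftable_Id_on: "sg_ideal M \<Longrightarrow> liftable M (Id_on M)"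
  by (rule liftableI) (auto intro!: equivI refl_onI symI transI simp: sg_ideal_def)

section \<open>Retractions\<close>

locale minimal_ideal_retraction =
  fixes M I :: "'a::semigroup_mult set" and f :: "'a \<Rightarrow> 'a"
  assumes minimal: "minimal_ideal M" and stable: "stable_class M"
    and ideal: "sg_ideal I" and retraction: "retraction M I f"
begin

lemmas ideal_M = minimal_ideal_sg_ideal[OF minimal]

text \<open>Both \<open>b\<close> and \<open>x * b\<close> are fixed by \<open>f\<close>, so
  applying \<open>f\<close> to \<open>x * b\<close> gives the claim.\<close>

lemma mult_retract:
  assumes "x \<in> I" "b \<in> M"
  shows "f x * b = x * b" "b * f x = b * x"
proof -
  have "x * b \<in> M" "b * x \<in> M" "b \<in> I"
    using assms sg_ideal_closed[OF ideal_M] minimal_ideal_subset[OF minimal ideal] by auto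
  then show "f x * b = x * b" "b * f x = b * x"
    using retraction assms unfolding retraction_def by metis+
qed

text \<open>\<open>f x\<close> acts on \<open>M\<close> as \<open>x\<close> does, and weak
  reductivity determines an element of \<open>M\<close> by its action.\<close>

lemma retract_eqI:
  assumes "x \<in> I" "c \<in> M" "\<And>b. b \<in> M \<Longrightarrow> x * b = c * b" "\<And>b. b \<in> M \<Longrightarrow> b * x = b * c"
  shows "f x = c"
proof (rule regular_ideal_weakly_reductive[OF ideal_M
      stable_minimal_ideal_regular[OF minimal stable] _ \<open>c \<in> M\<close>])
  show "f x \<in> M" using retraction assms(1) by (simp add: retraction_def)
  show "f x * b = c * b" "b * f x = b * c" if "b \<in> M" for b
    using mult_retract[OF assms(1) that] assms(3,4)[OF that] by simp_all
qed

text \<open>\<open>s\<close> may lie outside \<open>I\<close>, where the homomorphism property says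
  nothing; instead \<open>s * f x\<close> is recognised by its action on \<open>M\<close>.\<close>

lemma retract_mult:
  assumes "x \<in> I"
  shows "f (s * x) = s * f x" "f (x * s) = f x * s"
proof -
  have "f x \<in> M" using assms retraction by (simp add: retraction_def)
  then show "f (s * x) = s * f x" "f (x * s) = f x * s"
    using assms mult_retract sg_ideal_closed[OF ideal] sg_ideal_closed[OF ideal_M]
    by (auto intro!: retract_eqI simp: mult.assoc) (simp_all flip: mult.assoc)
qed

end

section \<open>IN-pairs\<close>

text \<open>Lets an equation between products rewrite inside right-nested products.\<close>

lemma mult_left_cong_assoc:
  fixes a b c :: "'a::semigroup_mult"
  assumes "a * b = c"
  shows "a * (b * w) = c * w"
  using assms by (simp flip: mult.assoc)

text \<open>Collects what the argument takes from an IN-pair, without \<open>S1\<close> or group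
  structures. In \<open>normal_N\<close>, \<open>g\<close> ranges over the units of eSe, which form
  the maximal subgroup.\<close>

locale IN_data =
  fixes I J N :: "'a::semigroup_mult set" and e :: 'a
  assumes ideal: "sg_ideal I" and disjoint: "J \<inter> I = {}"
    and J_eq: "green_J `` N = J"
    and mult_J: "x \<in> J \<Longrightarrow> s * x \<in> J \<union> I" "x \<in> J \<Longrightarrow> x * s \<in> J \<union> I"
    and stable_right: "x \<in> J \<Longrightarrow> x * a \<in> J \<Longrightarrow> \<exists>b. x * a * b = x"
    and stable_left: "x \<in> J \<Longrightarrow> a * x \<in> J \<Longrightarrow> \<exists>b. b * a * x = x"
    and one_N: "e \<in> N" and N_J: "N \<subseteq> J"
    and unit_N: "x \<in> N \<Longrightarrow> e * x = x" "x \<in> N \<Longrightarrow> x * e = x"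
    and mult_N: "x \<in> N \<Longrightarrow> y \<in> N \<Longrightarrow> x * y \<in> N"
    and inverse_N: "x \<in> N \<Longrightarrow> \<exists>x'\<in>N. x * x' = e \<and> x' * x = e"
    and normal_N: "\<lbrakk>x \<in> N; e * g = g; g * e = g; e * g' = g'; g' * e = g'; g * g' = e; g' * g = e\<rbrakk>
      \<Longrightarrow> g * x * g' \<in> N"
begin

lemma ideal_mult:
  assumes "x \<in> I"
  shows "s * x \<in> I" "x * s \<in> I"
  using ideal assms sg_ideal_closed by auto

text \<open>Some \<open>p\<close> undoes \<open>h\<close> on \<open>x\<close>, hence on
  \<open>y = x * x' * y\<close>. So \<open>h * x * k\<close> is a left multiple of
  \<open>h * y * k\<close>, which therefore cannot lie in \<open>I\<close>.\<close>

lemma sandwich_in_J: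
  assumes x: "x \<in> N" and y: "y \<in> N" and J: "h * x * k \<in> J"
  shows "h * y * k \<in> J"
proof -
  have "x \<in> J" "y \<in> J" using x y N_J by auto
  have "h * x \<in> J"
    using mult_J(1)[OF \<open>x \<in> J\<close>, of h] J disjoint ideal_mult(2)[of "h * x" k] by blast
  then obtain p where p: "p * h * x = x" using stable_left[OF \<open>x \<in> J\<close>] by blast
  obtain x' y' where inv: "x * x' = e" "y' * y = e" using inverse_N x y by meson
  have "p * h * (x * x' * y) = p * h * x * x' * y" by (simp only: mult.assoc)
  then have phy: "p * h * y = y" by (simp add: p inv unit_N y)
  have "h * x * y' * p * (h * y * k) = h * (x * (y' * (p * h * y))) * k"
    by (simp only: mult.assoc)
  then have "h * x * y' * p * (h * y * k) = h * x * k"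
    by (simp add: phy inv unit_N x)
  then have "h * y * k \<notin> I"
    using J disjoint ideal_mult(1)[of "h * y * k" "h * x * y' * p"] by auto
  moreover have "h * y * k \<in> J \<union> I"
    using mult_J(1)[OF \<open>y \<in> J\<close>, of h] mult_J(2)[of "h * y" k] ideal_mult(2)[of "h * y" k] by blast
  ultimately show ?thesis by simp
qed

text \<open>Writing elements of \<open>N\<close> as \<open>e * z * e\<close> turns outer factors
  from \<open>S1\<close> into elements of S. By \<open>sandwich_in_J\<close>, membership in
  \<open>J\<close> need be required of one component only.\<close>

lemma nu_eq: "nu N = {(h * x * k, h * y * k) | h k x y. x \<in> N \<and> y \<in> N \<and> h * x * k \<in> J}"
    (is "_ = ?R")
proof (rule equalityI; rule subrelI)
  fix a b assume "(a, b) \<in> nu N"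
  then obtain s t x y where x: "x \<in> N" and y: "y \<in> N" and "a \<in> J"
    and a: "a = rmult1 (lmult1 s x) t" and b: "b = rmult1 (lmult1 s y) t"
    unfolding nu_def J_eq by blast
  have split: "rmult1 (lmult1 s z) t = lmult1 s e * z * rmult1 e t" if "z \<in> N" for z
    using unit_N[OF that] mult_left_cong_assoc[OF unit_N(1)[OF that]]
      mult_left_cong_assoc[OF unit_N(2)[OF that]]
    by (cases s; cases t) (simp_all add: mult.assoc)
  show "(a, b) \<in> ?R"
    using x y \<open>a \<in> J\<close> unfolding a b split[OF x] split[OF y] by blast
next
  fix a b assume "(a, b) \<in> ?R"
  then obtain h k x y where N: "x \<in> N" "y \<in> N" and a: "a = h * x * k" "a \<in> J"
    and b: "b = h * y * k"
    by blast
  have "h * y * k \<in> J" using sandwich_in_J[OF N] a by simp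
  moreover have "h * z * k = rmult1 (lmult1 (Some h) z) (Some k)" for z
    by simp
  ultimately show "(a, b) \<in> nu N"
    using N a b Some_in_S1 unfolding nu_def J_eq by blast
qed

lemma nu_sandwich:
  assumes "x \<in> N" "y \<in> N" "h * x * k \<in> J"
  shows "(h * x * k, h * y * k) \<in> nu N"
  using assms unfolding nu_eq by blast

lemma nu_J: "nu N \<subseteq> J \<times> J"
  by (auto simp: nu_def J_eq)

section \<open>Symmetry and transitivity of \<open>nu N\<close>\<close>

lemma sym_nu: "sym (nu N)"
  unfolding nu_def sym_def by blast

lemma cancel_left:
  assumes "p * h * e = e" "e * u = u"
  shows "p * (h * u) = u"
proof -
  have "p * (h * (e * u)) = p * h * e * u" by (simp only: mult.assoc)
  then show ?thesis by (simp add: assms)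
qed

lemma sandwich_J_left:
  assumes "y \<in> N" "h * y * k \<in> J"
  shows "h * e \<in> J"
proof -
  have "h * e \<in> J \<union> I" using mult_J(1) one_N N_J by blast
  moreover have "h * e * k \<in> J" using sandwich_in_J[OF assms(1) one_N assms(2)] .
  ultimately show ?thesis using disjoint ideal_mult(2)[of "h * e" k] by blast
qed

text \<open>Compares the left factors of two sandwiches of the same element: right multiplication
  leads from that element to both \<open>h * e\<close> and \<open>h' * e\<close>, which yields
  mutually inverse units.\<close>

lemma sandwich_unit:
  assumes N: "y \<in> N" "x \<in> N" and J: "h * y * k \<in> J" and eq: "h * y * k = h' * x * k'"
  obtains g g' where "e * g = g" "g * e = g" "e * g' = g'" "g' * e = g'" "g * g' = e" "g' * g = e"
    "h' * e = h * g"
proof -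
  have *: "\<exists>p b. p * h * e = e \<and> h * y * k * b = h * e"
    if y: "y \<in> N" and hyk: "h * y * k \<in> J" for h y k
  proof -
    have "e \<in> J" "y \<in> J" using one_N N_J y by auto
    note unit_y = mult_left_cong_assoc[OF unit_N(1)[OF y]]
    have hJ: "h * e \<in> J"
      using sandwich_J_left[OF y hyk] .
    have eq: "h * e * (y * k) = h * y * k" by (simp add: mult.assoc unit_y)
    then obtain b where "h * y * k * b = h * e"
      using stable_right[OF hJ, of "y * k"] hyk by auto
    moreover obtain p where "p * h * e = e" using stable_left[OF \<open>e \<in> J\<close> hJ] by blast
    ultimately show ?thesis by blast
  qed
  obtain p b where p: "p * h * e = e" and b: "h * y * k * b = h * e" using *[OF N(1) J] by blast
  obtain p' b' where p': "p' * h' * e = e" and b': "h' * x * k' * b' = h' * e"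
    using *[OF N(2), of h' k'] J eq by auto
  have ee: "e * e = e" using unit_N one_N by blast
  \<comment> \<open>\<open>b'\<close> carries the common element to \<open>h' * e\<close>, so
    \<open>h * g = h' * e\<close>; symmetrically \<open>h' * g' = h * e\<close>. The final
    \<open>e\<close> places both in eSe.\<close>
  define g g' where "g = y * k * b' * e" and "g' = x * k' * b * e"
  have ids: "e * g = g" "g * e = g" "e * g' = g'" "g' * e = g'"
    using mult_left_cong_assoc[OF unit_N(1)[OF N(1)]] mult_left_cong_assoc[OF unit_N(1)[OF N(2)]]
    by (simp_all add: g_def g'_def mult.assoc ee)
  have "h * g = h * y * k * b' * e" by (simp only: g_def mult.assoc)
  also have "\<dots> = h' * e * e" by (simp only: eq b')
  finally have g: "h * g = h' * e" by (simp add: mult.assoc ee)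
  have "h' * g' = h' * x * k' * b * e" by (simp only: g'_def mult.assoc)
  also have "\<dots> = h * e * e" by (simp only: eq[symmetric] b)
  finally have g': "h' * g' = h * e" by (simp add: mult.assoc ee)
  \<comment> \<open>\<open>h * g * g' = h' * g' = h * e\<close>, and \<open>p\<close> cancels
    \<open>h\<close> on eS.\<close>
  have "h * (g * g') = h * e"
    using mult_left_cong_assoc[OF g, of g'] g' ids by (simp add: mult.assoc)
  then have "g * g' = e"
    using cancel_left[OF p mult_left_cong_assoc[OF ids(1)]] cancel_left[OF p ee] by metis
  have "h' * (g' * g) = h' * e"
    using mult_left_cong_assoc[OF g', of g] g ids by (simp add: mult.assoc)
  then have "g' * g = e"
    using cancel_left[OF p' mult_left_cong_assoc[OF ids(3)]] cancel_left[OF p' ee] by metis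
  note h'_eq = g[symmetric]
  show ?thesis by (rule that) fact+
qed

lemma trans_nu: "trans (nu N)"
proof (rule transI)
  fix a b c assume "(a, b) \<in> nu N" "(b, c) \<in> nu N"
  then obtain h k x y h' k' x' y'
    where N: "x \<in> N" "y \<in> N" "x' \<in> N" "y' \<in> N" and a: "a = h * x * k" "a \<in> J"
      and b: "b = h * y * k" "b = h' * x' * k'" and c: "c = h' * y' * k'"
    unfolding nu_eq by blast
  have J: "h * y * k \<in> J" using sandwich_in_J N a by blast
  obtain g g' where g: "e * g = g" "g * e = g" "e * g' = g'" "g' * e = g'" "g * g' = e" "g' * g = e"
    and h': "h' * e = h * g"
    using sandwich_unit[OF N(2) N(3) J] b by metis
  have he: "h * e \<in> J"
    using sandwich_J_left[OF N(2) J] .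
  obtain p where p: "p * h * e = e"
    using stable_left[OF _ he] one_N N_J by blast
  obtain z where z: "z \<in> N" "x' * z = e" "z * x' = e" using inverse_N N by blast
  note assoc = mult_left_cong_assoc
  have split_h': "h' * (w * k) = h * (g * (w * k))" if "w \<in> N" for w k
    using assoc[OF h', of "w * k"] assoc[OF unit_N(1)[OF that]] by (simp add: mult.assoc)
  \<comment> \<open>Both sides are \<open>b\<close>. Cancelling \<open>h\<close>, then
    \<open>g\<close>, expresses \<open>x' * k'\<close> through \<open>y * k\<close>; with the
    inverse \<open>z\<close> of \<open>x'\<close> this removes \<open>k'\<close> from
    \<open>c\<close>.\<close>
  have "h * (y * k) = h * (g * (x' * k'))"
    using b split_h'[OF N(3)] by (simp add: mult.assoc)
  then have "y * k = g * (x' * k')"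
    using cancel_left[OF p assoc[OF unit_N(1)[OF N(2)]]] cancel_left[OF p assoc[OF g(1)]] by metis
  then have "g' * (y * k) = x' * k'"
    by (simp add: assoc[OF g(6)] assoc[OF unit_N(1)[OF N(3)]])
  then have "y' * (z * (g' * (y * k))) = y' * k'"
    by (simp add: assoc[OF z(3)] assoc[OF unit_N(2)[OF N(4)]])
  then have "c = h * (g * (y' * z) * g' * y) * k"
    using c split_h'[OF N(4), of k'] by (simp add: mult.assoc)
  moreover have "g * (y' * z) * g' * y \<in> N"
    using normal_N[of "y' * z" g g'] g z N mult_N by blast
  ultimately show "(a, c) \<in> nu N"
    using nu_sandwich[OF N(1), of _ h k] a by blast
qed

text \<open>Multiplying by \<open>u\<close> changes only an outer factor of the sandwiches, so
  \<open>sandwich_in_J\<close> prevents one product from lying in \<open>J\<close> and the other in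
  \<open>I\<close>.\<close>

lemma nu_mult:
  assumes "(a, b) \<in> nu N"
  shows "(u * a, u * b) \<in> nu N \<or> u * a \<in> I \<and> u * b \<in> I"
    and "(a * u, b * u) \<in> nu N \<or> a * u \<in> I \<and> b * u \<in> I"
proof -
  obtain h k x y where N: "x \<in> N" "y \<in> N" and ab: "a = h * x * k" "b = h * y * k"
    using assms unfolding nu_eq by blast
  have J: "a \<in> J" "b \<in> J" using assms nu_J by auto
  have left: "u * a = (u * h) * x * k" "u * b = (u * h) * y * k"
    and right: "a * u = h * x * (k * u)" "b * u = h * y * (k * u)"
    using ab by (simp_all add: mult.assoc)
  have "u * b \<in> J \<Longrightarrow> u * a \<in> J" "b * u \<in> J \<Longrightarrow> a * u \<in> J"
    unfolding left right by (rule sandwich_in_J[OF N(2,1)], assumption)+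
  moreover have "u * a \<in> J \<Longrightarrow> (u * a, u * b) \<in> nu N" "a * u \<in> J \<Longrightarrow> (a * u, b * u) \<in> nu N"
    unfolding left right by (rule nu_sandwich[OF N], assumption)+
  ultimately show "(u * a, u * b) \<in> nu N \<or> u * a \<in> I \<and> u * b \<in> I"
    and "(a * u, b * u) \<in> nu N \<or> a * u \<in> I \<and> b * u \<in> I"
    using mult_J[OF J(1), of u] mult_J[OF J(2), of u] by blast+
qed

text \<open>Covers \<open>R\<close> with \<open>\<rho> = I \<times> I\<close> and \<open>\<zeta>\<close> with the pullback of \<open>\<xi>\<close> along the retraction.\<close>

lemma congruence_Un_nu:
  assumes equiv: "equiv I \<rho>"
    and compatible: "\<And>x y s. (x, y) \<in> \<rho> \<Longrightarrow> (s * x, s * y) \<in> \<rho> \<and> (x * s, y * s) \<in> \<rho>"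
    and sandwich: "\<And>x y h k. \<lbrakk>x \<in> N; y \<in> N; h * x * k \<in> I; h * y * k \<in> I\<rbrakk>
      \<Longrightarrow> (h * x * k, h * y * k) \<in> \<rho>"
  shows "congruence (Id \<union> nu N \<union> \<rho>)"
  unfolding congruence_on_def
proof (intro conjI allI impI ballI)
  have \<rho>_I: "\<rho> \<subseteq> I \<times> I" using equiv by (auto simp: equiv_def)
  show "equiv UNIV (Id \<union> nu N \<union> \<rho>)"
  proof (intro equivI)
    show "sym (Id \<union> nu N \<union> \<rho>)"
      using sym_nu equiv by (auto simp: equiv_def sym_def)
    show "trans (Id \<union> nu N \<union> \<rho>)"
    proof -
      have "trans \<rho>" using equiv by (simp add: equiv_def)
      \<comment> \<open>Chains mixing the two relations would need an element in both
        \<open>J\<close> and \<open>I\<close>.\<close>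
      moreover have False if "(x, y) \<in> nu N \<and> (y, z) \<in> \<rho> \<or> (x, y) \<in> \<rho> \<and> (y, z) \<in> nu N" for x y z
        using that \<rho>_I nu_J disjoint by blast
      ultimately show ?thesis
        using trans_nu unfolding trans_def by blast
    qed
  qed (auto simp: refl_on_def)
  fix a b s assume "(a, b) \<in> Id \<union> nu N \<union> \<rho>"
  then consider "a = b" | "(a, b) \<in> nu N" | "(a, b) \<in> \<rho>" by blast
  then have "(s * a, s * b) \<in> Id \<union> nu N \<union> \<rho> \<and> (a * s, b * s) \<in> Id \<union> nu N \<union> \<rho>"
  proof cases
    case 2
    then obtain h k x y where *: "x \<in> N" "y \<in> N" "a = h * x * k" "b = h * y * k"
      unfolding nu_eq by blast
    have "s * a \<in> I \<and> s * b \<in> I \<Longrightarrow> (s * a, s * b) \<in> \<rho>"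
      using sandwich[of x y "s * h" k] * by (simp add: mult.assoc)
    moreover have "a * s \<in> I \<and> b * s \<in> I \<Longrightarrow> (a * s, b * s) \<in> \<rho>"
      using sandwich[of x y h "k * s"] * by (simp add: mult.assoc)
    ultimately show ?thesis using nu_mult[OF 2] by blast
  qed (use compatible in auto)
  then show "(s * a, s * b) \<in> Id \<union> nu N \<union> \<rho>" "(a * s, b * s) \<in> Id \<union> nu N \<union> \<rho>" by auto
qed

lemma congruence_R_rel: "congruence (R_rel I N)"
  unfolding R_rel_def
  by (rule congruence_Un_nu)
    (auto intro!: equivI refl_onI symI transI simp: ideal_mult)

lemma congruence_zeta:
  assumes M: "minimal_ideal M" "stable_class M" and f: "retraction M I f"
    and single: "\<And>z x y. \<lbrakk>z \<in> M; x \<in> N; y \<in> N\<rbrakk> \<Longrightarrow> z * x = z * y \<and> x * z = y * z"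
    and \<xi>: "liftable M \<xi>"
  shows "congruence (zeta f I N \<xi>)"
proof -
  interpret minimal_ideal_retraction M I f
    using M f ideal by unfold_locales
  have f_M: "f x \<in> M" if "x \<in> I" for x using f that by (simp add: retraction_def)
  have equiv: "equiv M \<xi>" using \<xi> by (simp add: liftable_def congruence_on_def)
  let ?\<rho> = "{(x, y). x \<in> I \<and> y \<in> I \<and> (f x, f y) \<in> \<xi>}"
  have "congruence (Id \<union> nu N \<union> ?\<rho>)"
  proof (rule congruence_Un_nu)
    show "equiv I ?\<rho>"
    proof (rule equivI)
      show "?\<rho> \<subseteq> I \<times> I" by auto
      show "refl_on I ?\<rho>" using equiv f_M by (auto simp: equiv_def refl_on_def)
      show "sym ?\<rho>" using equiv by (auto simp: equiv_def sym_def)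
      show "trans ?\<rho>" using equiv unfolding equiv_def trans_def by blast
    qed
    show "(s * x, s * y) \<in> ?\<rho> \<and> (x * s, y * s) \<in> ?\<rho>" if "(x, y) \<in> ?\<rho>" for x y s
      using that liftable_mult[OF ideal_M \<xi>] by (auto simp: retract_mult ideal_mult)
    show "(h * x * k, h * y * k) \<in> ?\<rho>"
      if "x \<in> N" "y \<in> N" "h * x * k \<in> I" "h * y * k \<in> I" for x y h k
    proof -
      have right: "h * x * k * b = h * y * k * b" and left: "b * (h * x * k) = b * (h * y * k)"
        if "b \<in> M" for b
      proof -
        have "x * (k * b) = y * (k * b)" "b * h * x = b * h * y"
          using single sg_ideal_closed[OF ideal_M that] \<open>x \<in> N\<close> \<open>y \<in> N\<close> by blast+
        then show "h * x * k * b = h * y * k * b" "b * (h * x * k) = b * (h * y * k)"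
          by (metis mult.assoc)+
      qed
      \<comment> \<open>\<open>retract_eqI\<close> with \<open>c = f (h * y * k)\<close>, which acts
        on \<open>M\<close> as \<open>h * y * k\<close> does.\<close>
      have "f (h * x * k) = f (h * y * k)"
        using that f_M right left mult_retract by (intro retract_eqI) auto
      then show ?thesis using that f_M equiv by (auto simp: equiv_def refl_on_def)
    qed
  qed
  then show ?thesis by (simp add: zeta_def)
qed

end

section \<open>Maximal subgroups and the data of an IN-pair\<close>

lemma grp_iff:
  "group (grp G e) \<longleftrightarrow> e \<in> G \<and> (\<forall>x\<in>G. \<forall>y\<in>G. x * y \<in> G) \<and>
    (\<forall>x\<in>G. e * x = x \<and> x * e = x \<and> (\<exists>y\<in>G. y * x = e \<and> x * y = e))"
  (is "?L \<longleftrightarrow> ?R")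
proof
  assume ?L
  then interpret group "grp G e" .
  show ?R
    using one_closed m_closed l_one r_one l_inv_ex r_inv inv_closed l_inv
    by (simp; metis)
next
  assume ?R
  then show ?L by (intro groupI) (auto simp: mult.assoc)
qed

text \<open>The units of eSe form a group containing \<open>G\<close>, so by maximality they are
  \<open>G\<close>.\<close>

lemma maximal_subgroup_unit:
  assumes "maximal_subgroup G" "group (grp G e)"
    and "e * g = g" "g * e = g" "e * g' = g'" "g' * e = g'" "g * g' = e" "g' * g = e"
  shows "g \<in> G"
proof -
  define H where "H = {g. e * g = g \<and> g * e = g \<and>
    (\<exists>g'. e * g' = g' \<and> g' * e = g' \<and> g * g' = e \<and> g' * g = e)}"
  have "\<exists>w. e * w = w \<and> w * e = w \<and> (x * y) * w = e \<and> w * (x * y) = e"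
    if "x \<in> H" "y \<in> H" for x y
  proof -
    obtain x' y' where "e * x' = x'" "x' * e = x'" "x * x' = e" "x' * x = e"
      "e * y' = y'" "y' * e = y'" "y * y' = e" "y' * y = e"
      using \<open>x \<in> H\<close> \<open>y \<in> H\<close> by (auto simp: H_def)
    then have "e * (y' * x') = y' * x'" "(y' * x') * e = y' * x'"
      "(x * y) * (y' * x') = e" "(y' * x') * (x * y) = e"
      using that unfolding H_def by (smt (verit) mem_Collect_eq mult.assoc)+
    then show ?thesis by blast
  qed
  then have "\<forall>x\<in>H. \<forall>y\<in>H. x * y \<in> H"
    unfolding H_def by (smt (verit) mem_Collect_eq mult.assoc)
  moreover have "e * e = e" using assms(2) by (auto simp: grp_iff)
  ultimately have "group (grp H e)"
    unfolding grp_iff by (auto simp: H_def)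
  moreover have "G \<subseteq> H"
    using assms(2) unfolding grp_iff H_def by blast
  ultimately have "H = G"
    using assms(1) by (auto simp: maximal_subgroup_def sg_subgroup_def)
  moreover have "g \<in> H" using assms by (auto simp: H_def)
  ultimately show ?thesis by simp
qed

text \<open>If \<open>y\<close> is outside \<open>I\<close>, so is its whole J-class, since
  \<open>I\<close> is an ideal. That class lies below \<open>J\<close>, hence is \<open>J\<close> by
  minimality.\<close>

lemma minimal_J_class_outside_mult:
  assumes I: "sg_ideal I" and J: "minimal_J_class_outside I J" and x: "x \<in> J"
    and y: "y \<in> ideal1 x"
  shows "y \<in> J \<union> I"
proof (rule ccontr)
  assume "y \<notin> J \<union> I"
  let ?K = "green_J `` {y}"
  have "w \<notin> I" if "w \<in> ?K" for w
  proof
    assume "w \<in> I"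
    moreover have "y \<in> ideal1 w" using that self_in_ideal1[of y] by (simp add: green_J_def)
    ultimately show False using ideal1_subset[OF I] \<open>y \<notin> J \<union> I\<close> by blast
  qed
  moreover have "y \<in> ?K" by (simp add: green_J_def)
  moreover have "J_le ?K J"
    unfolding J_le_def using \<open>y \<in> ?K\<close> x y by blast
  moreover have "?K \<in> J_classes" by (simp add: J_classes_def quotientI)
  ultimately have "?K = J"
    using J unfolding minimal_J_class_outside_def by blast
  with \<open>y \<in> ?K\<close> \<open>y \<notin> J \<union> I\<close> show False by blast
qed

lemma IN_pair_IN_data:
  assumes "IN_pair I N"
  obtains J e where "IN_data I J N e"
proof -
  from assms obtain J G e where I: "sg_ideal I" and J: "minimal_J_class_outside I J"
    and stable: "stable_class J" "regular_class J" and G: "maximal_subgroup G" "G \<subseteq> J"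
    and N: "N \<lhd> grp G e"
    by (auto simp: IN_pair_def normal_subgroup_def)
  interpret N: normal N "grp G e" by fact
  have group: "group (grp G e)" by (rule N.is_group)
  have J_class: "J \<in> J_classes" "J \<subseteq> - I" using J by (auto simp: minimal_J_class_outside_def)
  have NG: "N \<subseteq> G" using N.subset by simp
  have e: "e \<in> N" using subgroup.one_closed[OF N.subgroup_axioms] by simp
  \<comment> \<open>Normality is stated with the group's inverse, which must be identified with the
    given \<open>g'\<close>.\<close>
  have inverse: "inv\<^bsub>grp G e\<^esub> g = g'" if "g \<in> G" "g' \<in> G" "g' * g = e" for g g'
    using N.inv_equality[of g' g] that by simp
  have "IN_data I J N e"
  proof
    show "green_J `` N = J"
      using J_class_green_J[OF J_class(1)] e NG G(2) by blast
    show "\<exists>x'\<in>N. x * x' = e \<and> x' * x = e" if "x \<in> N" for x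
      using subgroup.m_inv_closed[OF N.subgroup_axioms that] N.r_inv[of x] N.l_inv[of x] that NG by auto
    show "g * x * g' \<in> N"
      if "x \<in> N" "e * g = g" "g * e = g" "e * g' = g'" "g' * e = g'" "g * g' = e" "g' * g = e"
      for x g g'
    proof -
      have "g \<in> G" "g' \<in> G"
        using maximal_subgroup_unit[OF G(1) group] that by blast+
      with N.inv_op_closed2[of g x] inverse that show ?thesis by simp
    qed
    show "x * y \<in> N" if "x \<in> N" "y \<in> N" for x y
      using subgroup.m_closed[OF N.subgroup_axioms that] by simp
    show "e * x = x" "x * e = x" if "x \<in> N" for x
      using group NG that by (auto simp: grp_iff)
    show "\<exists>b. x * a * b = x" if "x \<in> J" "x * a \<in> J" for x a
      using stable_regular_classD(1)[OF J_class(1) stable that] .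
    show "\<exists>b. b * a * x = x" if "x \<in> J" "a * x \<in> J" for x a
      using stable_regular_classD(2)[OF J_class(1) stable that] .
    show "s * x \<in> J \<union> I" "x * s \<in> J \<union> I" if "x \<in> J" for x s
      using minimal_J_class_outside_mult[OF I J that] mult_in_ideal1 by blast+
  qed (use I J_class e NG G in auto)
  then show ?thesis by (rule that)
qed

theorem proposition3p23:
  fixes M I N :: "'a::semigroup_mult set"
  assumes "minimal_ideal M" and "stable_class M"
    and "IN_pair I N"
  shows "congruence (R_rel I N) \<and>
    (retractable_IN_pair M I N \<longrightarrow>
      (\<forall>f. retraction M I f \<longrightarrow>
        (\<forall>\<xi>. liftable M \<xi> \<longrightarrow> congruence (zeta f I N \<xi>)) \<and>
        congruence (lambda_rel M f I N) \<and>
        congruence (rho_rel M f I N) \<and>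
        congruence (mu_rel M f I N) \<and>
        congruence (eta_rel M f I N)))"
proof -
  obtain J e where "IN_data I J N e" using assms(3) by (rule IN_pair_IN_data)
  then interpret IN_data I J N e .
  have zeta: "congruence (zeta f I N \<xi>)"
    if retractable: "retractable_IN_pair M I N" and "retraction M I f" "liftable M \<xi>" for f \<xi>
  proof (rule congruence_zeta[OF assms(1,2) that(2) _ that(3)])
    fix z x y assume "z \<in> M" "x \<in> N" "y \<in> N"
    then have "card ((\<lambda>n. z * n) ` N) = 1" "card ((\<lambda>n. n * z) ` N) = 1"
      using retractable by (auto simp: retractable_IN_pair_def)
    \<comment> \<open>Singleton images mean that all elements of \<open>N\<close> act alike on
      \<open>z\<close>.\<close>
    then obtain c d where "(\<lambda>n. z * n) ` N = {c}" "(\<lambda>n. n * z) ` N = {d}"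
      by (elim card_1_singletonE) rule
    with \<open>x \<in> N\<close> \<open>y \<in> N\<close> show "z * x = z * y \<and> x * z = y * z"
      by (simp add: set_eq_subset image_subset_iff)
  qed
  \<comment> \<open>The four named relations are instances of \<open>zeta\<close> at liftable
    congruences.\<close>
  show ?thesis
    unfolding lambda_rel_def rho_rel_def mu_rel_def eta_rel_def
    by (intro conjI impI allI congruence_R_rel zeta liftable_green[OF assms(1,2)]
        liftable_Id_on[OF minimal_ideal_sg_ideal[OF assms(1)]]) assumption+
qed

end
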